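(* Fix any realizable task law $\Pi$, and for $\varepsilon>0$ define a rescaled law $\Pi^{(\varepsilon)}$ as the law of the task obtained from $(X_t,y_t)\sim\Pi$ by $(X_t,y_t)\mapsto(\varepsilon X_t,\varepsilon y_t)$. Then: (i) the exact-fit projector law is unchanged, so that $P_t$, $\bar P$, $S_\Pi$, $\rho_\Pi$, and all the projection-based quantities $\mathcal R^\Pi(k)$, $f_m$, $\kappa_m$, $\lambda_\Pi$, $\nu_\Pi$ (and any other quantity determined by the law of the projectors alone) are the same under $\Pi$ and $\Pi^{(\varepsilon)}$; (ii) the actual forgetting loss scales by $\varepsilon^2$, namely, for every $k\ge1$, $F^{\Pi^{(\varepsilon)}}(k)=\varepsilon^2F^\Pi(k)$.
   Context: A task is a pair $(X,y)$ with $X\in\mathbb R^{n\times d}$, $y\in\mathbb R^n$ ($n\ge1$ may depend on the task) and $\operatorname{rank}(X)<d$. $\Pi$ is a probability distribution on tasks; it is realizable if there is a fixed vector $w^\star\in\mathbb R^d$ with $y=Xw^\star$ for every task under consideration (common solution). Tasks $(X_1,y_1),(X_2,y_2),\dots$ are i.i.d. from $\Pi$, with $X_t\in\mathbb R^{n_t\times d}$. Write $X^+$ for the Moore–Penrose pseudoinverse and $P_t:=I-X_t^+X_t$, the orthogonal projector onto $\operatorname{null}(X_t)$. Exact-fit iterates: $w_0=0$ and, for $t\ge1$, $w_t:=\arg\min\{\tfrac12\|w-w_{t-1}\|_2^2:\ w\in\mathbb R^d,\ X_tw=y_t\}$; equivalently $w_t=w_{t-1}+X_t^+(y_t-X_tw_{t-1})=w^\star+P_t(w_{t-1}-w^\star)$.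 Forgetting: $\ell_t(w):=\tfrac1{n_t}\|X_tw-y_t\|_2^2$ and $F^\Pi(k):=\mathbb E\big[\tfrac1k\sum_{t=1}^k\ell_t(w_k)\big]$. All expectations appearing are assumed finite; in particular $\mathbb E\|\tfrac1{n_t}X_t^\top X_t\|_F<\infty$. Projection-based quantities: $\bar P:=\mathbb E[P_t]$; $S_\Pi(A):=\mathbb E[P_tAP_t]$ on the space of symmetric $d\times d$ matrices; $\rho_\Pi$ is the operator norm of $S_\Pi$ with respect to the Frobenius norm; $\mathcal R^\Pi(k):=\mathbb E\big[\tfrac1k\sum_{t=1}^{k-1}\|(I-P_t)P_k\cdots P_1\|_2^2\big]$ ($\|\cdot\|_2$ the spectral norm); $f_m:=\mathbb E\|(I-P)P_m\cdots P_1\|_F^2$ with $P,P_1,\dots,P_m$ i.i.d. projector samples from $\Pi$; $\kappa_1:=\operatorname{tr}(\bar P)$, $\kappa_m:=\operatorname{tr}(S_\Pi^{m-1}(\bar P))$ for $m\ge2$; $\lambda_\Pi:=\|\bar P\|_2$; $\nu_\Pi:=\operatorname{tr}(\bar P)$. *)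

theory Defs
  imports "HOL-Probability.Probability"
begin

text \<open>
  The number of rows of a task varies within one law, so a task \<open>(X, y)\<close> with
  \<open>X \<in> \<real>\<^bsup>n\<times>d\<^esup>\<close> is a triple \<open>(n, X, y)\<close>: \<open>X i\<close> is the \<open>i\<close>-th row of the data
  matrix and \<open>y i\<close> the \<open>i\<close>-th label, for \<open>i < n\<close>.  In \<open>task_space\<close> both are padded
  by zeros from \<open>n\<close> on, so every task has exactly one representation there, and the
  \<open>\<sigma>\<close>-algebra is the Borel \<open>\<sigma>\<close>-algebra of the disjoint union over \<open>n \<ge> 1\<close> of the
  spaces \<open>\<real>\<^bsup>n\<times>d\<^esup> \<times> \<real>\<^bsup>n\<^esup>\<close>.
\<close>

type_synonym 'd task = "nat \<times> (nat \<Rightarrow> real^'d) \<times> (nat \<Rightarrow> real)"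

definition nrows :: "'d::finite task \<Rightarrow> nat" where
  "nrows \<tau> = fst \<tau>"

definition data :: "'d::finite task \<Rightarrow> nat \<Rightarrow> real^'d" where
  "data \<tau> = fst (snd \<tau>)"

definition label :: "'d::finite task \<Rightarrow> nat \<Rightarrow> real" where
  "label \<tau> = snd (snd \<tau>)"

definition task_space :: "'d::finite task measure" where
  "task_space = restrict_space borel
     {\<tau>. nrows \<tau> \<ge> 1 \<and> (\<forall>i\<ge>nrows \<tau>. data \<tau> i = 0 \<and> label \<tau> i = 0)}"

definition task_rank :: "'d::finite task \<Rightarrow> nat" where
  "task_rank \<tau> = dim (data \<tau> ` {..<nrows \<tau>})"

definition fits :: "'d::finite task \<Rightarrow> real^'d \<Rightarrow> bool" where
  "fits \<tau> w \<longleftrightarrow> (\<forall>i<nrows \<tau>. data \<tau> i \<bullet> w = label \<tau> i)"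

definition outer :: "real^'d \<Rightarrow> real^'d \<Rightarrow> real^'d^'d" where
  "outer u v = (\<chi> a b. u $ a * v $ b)"

definition gram :: "'d::finite task \<Rightarrow> real^'d^'d" where
  "gram \<tau> = (1 / real (nrows \<tau>)) *\<^sub>R (\<Sum>i<nrows \<tau>. outer (data \<tau> i) (data \<tau> i))"

definition task_law :: "'d::finite task measure \<Rightarrow> bool" where
  "task_law \<mu> \<longleftrightarrow> prob_space \<mu> \<and> sets \<mu> = sets task_space \<and>
     (AE \<tau> in \<mu>. task_rank \<tau> < CARD('d))"

definition realizable :: "'d::finite task measure \<Rightarrow> bool" where
  "realizable \<mu> \<longleftrightarrow> (\<exists>w. AE \<tau> in \<mu>. fits \<tau> w)"

text \<open>
  Coordinate \<open>t \<ge> 1\<close> is the \<open>t\<close>-th task of the i.i.d. sequence; coordinate \<open>0\<close> is one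
  further independent sample.
\<close>

definition iid :: "'d::finite task measure \<Rightarrow> (nat \<Rightarrow> 'd task) measure" where
  "iid \<mu> = PiM UNIV (\<lambda>_. \<mu>)"

text \<open>
  Moore--Penrose pseudoinverse.  The \<open>d \<times> n\<close> matrix \<open>X\<^sup>+\<close> is given by its columns
  \<open>G j\<close>, \<open>j < n\<close>, again padded by zeros.  Then \<open>pinv_prod\<close> is the \<open>d \<times> d\<close> matrix
  \<open>G X\<close>, the \<open>(i, j)\<close> entry of \<open>X G\<close> is \<open>data \<tau> i \<bullet> G j\<close>, and the four conjuncts
  after the padding condition are the Penrose equations \<open>X (G X) = X\<close> (row by row),
  \<open>(G X) G = G\<close> (column by column), and symmetry of \<open>X G\<close> and of \<open>G X\<close>.
\<close>

definition pinv_prod :: "'d::finite task \<Rightarrow> (nat \<Rightarrow> real^'d) \<Rightarrow> real^'d^'d" where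
  "pinv_prod \<tau> G = (\<Sum>i<nrows \<tau>. outer (G i) (data \<tau> i))"

definition is_pinv :: "'d::finite task \<Rightarrow> (nat \<Rightarrow> real^'d) \<Rightarrow> bool" where
  "is_pinv \<tau> G \<longleftrightarrow>
     (\<forall>j\<ge>nrows \<tau>. G j = 0) \<and>
     (\<forall>i<nrows \<tau>. data \<tau> i v* pinv_prod \<tau> G = data \<tau> i) \<and>
     (\<forall>j<nrows \<tau>. pinv_prod \<tau> G *v G j = G j) \<and>
     (\<forall>i<nrows \<tau>. \<forall>j<nrows \<tau>. data \<tau> i \<bullet> G j = data \<tau> j \<bullet> G i) \<and>
     transpose (pinv_prod \<tau> G) = pinv_prod \<tau> G"

definition pinv :: "'d::finite task \<Rightarrow> nat \<Rightarrow> real^'d" where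
  "pinv \<tau> = (THE G. is_pinv \<tau> G)"

definition proj :: "'d::finite task \<Rightarrow> real^'d^'d" where
  "proj \<tau> = mat 1 - pinv_prod \<tau> (pinv \<tau>)"

primrec iterate :: "(nat \<Rightarrow> 'd::finite task) \<Rightarrow> nat \<Rightarrow> real^'d" where
  "iterate \<omega> 0 = 0"
| "iterate \<omega> (Suc t) =
     (ARG_MIN (\<lambda>w. 1/2 * (norm (w - iterate \<omega> t))\<^sup>2) w. fits (\<omega> (Suc t)) w)"

definition loss :: "'d::finite task \<Rightarrow> real^'d \<Rightarrow> real" where
  "loss \<tau> w = (1 / real (nrows \<tau>)) * (\<Sum>i<nrows \<tau>. (data \<tau> i \<bullet> w - label \<tau> i)\<^sup>2)"

definition avg_loss :: "nat \<Rightarrow> (nat \<Rightarrow> 'd::finite task) \<Rightarrow> real" where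
  "avg_loss k \<omega> = (1 / real k) * (\<Sum>t=1..k. loss (\<omega> t) (iterate \<omega> k))"

definition forgetting :: "'d::finite task measure \<Rightarrow> nat \<Rightarrow> real" where
  "forgetting \<mu> k = (\<integral>\<omega>. avg_loss k \<omega> \<partial>iid \<mu>)"

text \<open>
  The remaining expectations are of bounded quantities, because \<open>proj \<tau>\<close> is an
  orthogonal projector.  On \<open>real^'d^'d\<close> the library \<open>norm\<close> is the Frobenius norm.
\<close>

definition finite_expectations :: "'d::finite task measure \<Rightarrow> bool" where
  "finite_expectations \<mu> \<longleftrightarrow>
     integrable \<mu> (\<lambda>\<tau>. norm (gram \<tau>)) \<and> (\<forall>k\<ge>1. integrable (iid \<mu>) (avg_loss k))"

definition spectral_norm :: "real^'d^'d::finite \<Rightarrow> real" where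
  "spectral_norm A = onorm ((*v) A)"

definition proj_law :: "'d::finite task measure \<Rightarrow> (real^'d^'d) measure" where
  "proj_law \<mu> = distr \<mu> borel proj"

definition mean_proj :: "'d::finite task measure \<Rightarrow> real^'d^'d" where
  "mean_proj \<mu> = (\<integral>\<tau>. proj \<tau> \<partial>\<mu>)"

definition S_op :: "'d::finite task measure \<Rightarrow> real^'d^'d \<Rightarrow> real^'d^'d" where
  "S_op \<mu> A = (\<integral>\<tau>. proj \<tau> ** A ** proj \<tau> \<partial>\<mu>)"

text \<open>
  The library \<open>onorm\<close> ranges over the whole type, whereas \<open>S_op \<mu>\<close> is considered as
  an operator on symmetric matrices only.
\<close>

definition rho :: "'d::finite task measure \<Rightarrow> real" where
  "rho \<mu> = (SUP A\<in>{A. transpose A = A}. norm (S_op \<mu> A) / norm A)"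

primrec proj_prod :: "(nat \<Rightarrow> 'd::finite task) \<Rightarrow> nat \<Rightarrow> real^'d^'d" where
  "proj_prod \<omega> 0 = mat 1"
| "proj_prod \<omega> (Suc m) = proj (\<omega> (Suc m)) ** proj_prod \<omega> m"

definition R_proj :: "'d::finite task measure \<Rightarrow> nat \<Rightarrow> real" where
  "R_proj \<mu> k = (\<integral>\<omega>. (1 / real k) *
     (\<Sum>t=1..k-1. (spectral_norm ((mat 1 - proj (\<omega> t)) ** proj_prod \<omega> k))\<^sup>2) \<partial>iid \<mu>)"

definition f_seq :: "'d::finite task measure \<Rightarrow> nat \<Rightarrow> real" where
  "f_seq \<mu> m = (\<integral>\<omega>. (norm ((mat 1 - proj (\<omega> 0)) ** proj_prod \<omega> m))\<^sup>2 \<partial>iid \<mu>)"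

definition kappa :: "'d::finite task measure \<Rightarrow> nat \<Rightarrow> real" where
  "kappa \<mu> m = trace ((S_op \<mu> ^^ (m - 1)) (mean_proj \<mu>))"

definition lam :: "'d::finite task measure \<Rightarrow> real" where
  "lam \<mu> = spectral_norm (mean_proj \<mu>)"

definition nu :: "'d::finite task measure \<Rightarrow> real" where
  "nu \<mu> = trace (mean_proj \<mu>)"

definition rescale :: "real \<Rightarrow> 'd::finite task \<Rightarrow> 'd task" where
  "rescale \<epsilon> \<tau> = (nrows \<tau>, (\<lambda>i. \<epsilon> *\<^sub>R data \<tau> i), (\<lambda>i. \<epsilon> * label \<tau> i))"

definition rescaled_law :: "real \<Rightarrow> 'd::finite task measure \<Rightarrow> 'd task measure" where
  "rescaled_law \<epsilon> \<mu> = distr \<mu> task_space (rescale \<epsilon>)"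

end

(*
  Scaling a task by \<epsilon> leaves its exact solutions, and hence the iterates, unchanged, and
  divides its pseudoinverse by \<epsilon>, so that X\<^sup>+ X is unchanged; residuals scale by \<epsilon>.
  As rescaling is an isomorphism of the task space, all expectations transport along it.
*)
theory Submission
  imports Defs
begin

section \<open>Transport along measurable isomorphisms\<close>

text \<open>
  For a measurable isomorphism the change of variables needs no measurability of the
  integrand: if the integrand is not measurable on one side, it is not on the other side
  either, and both integrals have the value \<open>0\<close>.
\<close>

lemma integral_distr_isomorphism:
  fixes f :: "'b \<Rightarrow> 'c::{banach, second_countable_topology}"
  assumes T: "T \<in> measurable M N" and T': "T' \<in> measurable N M"
    and TT': "\<And>y. y \<in> space N \<Longrightarrow> T (T' y) = y"
  shows "(\<integral>y. f y \<partial>distr M N T) = (\<integral>x. f (T x) \<partial>M)"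
proof (cases "f \<in> borel_measurable N")
  case True
  then show ?thesis by (rule integral_distr[OF T])
next
  case False
  have "(\<lambda>x. f (T x)) \<notin> borel_measurable M"
  proof
    assume "(\<lambda>x. f (T x)) \<in> borel_measurable M"
    \<comment> \<open>Composing with \<open>T'\<close> recovers \<open>f\<close> on
      \<open>space N\<close>, so non-measurability passes from \<open>f\<close> to its
      pullback.\<close>
    from measurable_compose[OF T' this] have "(\<lambda>y. f (T (T' y))) \<in> borel_measurable N" .
    then have "f \<in> borel_measurable N"
      by (rule measurable_cong[THEN iffD1, rotated]) (simp add: TT')
    with False show False ..
  qed
  then have "\<not> integrable M (\<lambda>x. f (T x))"
    using borel_measurable_integrable by blast
  moreover have "\<not> integrable (distr M N T) f"
    using False borel_measurable_integrable[of "distr M N T" f] by auto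
  ultimately show ?thesis
    by (simp add: not_integrable_integral_eq)
qed

text \<open>Here \<open>f\<close> is arbitrary: a preimage under \<open>f\<close> is measurable on
  one side iff it is on the other, and \<open>emeasure\<close> is 0 on non-measurable sets, so the
  set functions defining both sides agree.\<close>

lemma distr_distr_isomorphism:
  assumes T: "T \<in> measurable M N" and T': "T' \<in> measurable N M"
    and TT': "\<And>y. y \<in> space N \<Longrightarrow> T (T' y) = y"
  shows "distr (distr M N T) L f = distr M L (\<lambda>x. f (T x))"
proof -
  have "emeasure (distr M N T) (f -` A \<inter> space N) = emeasure M ((\<lambda>x. f (T x)) -` A \<inter> space M)"
    for A
  proof (cases "f -` A \<inter> space N \<in> sets N")
    case True
    moreover have "T -` (f -` A \<inter> space N) \<inter> space M = (\<lambda>x. f (T x)) -` A \<inter> space M"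
      using measurable_space[OF T] by auto
    ultimately show ?thesis by (simp add: emeasure_distr[OF T])
  next
    case False
    have "(\<lambda>x. f (T x)) -` A \<inter> space M \<notin> sets M"
    proof
      assume "(\<lambda>x. f (T x)) -` A \<inter> space M \<in> sets M"
      from measurable_sets[OF T' this]
      have "T' -` ((\<lambda>x. f (T x)) -` A \<inter> space M) \<inter> space N \<in> sets N" .
      moreover have "T' -` ((\<lambda>x. f (T x)) -` A \<inter> space M) \<inter> space N = f -` A \<inter> space N"
        using measurable_space[OF T'] TT' by auto
      ultimately show False using False by simp
    qed
    with False show ?thesis by (simp add: emeasure_notin_sets)
  qed
  \<comment> \<open>Fixing the target \<open>L\<close> unfolds only the outer \<open>distr\<close>
    and keeps \<open>distr M N T\<close> intact.\<close>
  then show ?thesis by (simp add: distr_def[of _ L])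
qed

section \<open>Product measures under coordinatewise maps\<close>

lemma measurable_PiM_map:
  assumes "T \<in> measurable M N"
  shows "(\<lambda>\<omega>. \<lambda>i\<in>I. T (\<omega> i)) \<in> measurable (PiM I (\<lambda>_. M)) (PiM I (\<lambda>_. N))"
  by (intro measurable_restrict measurable_compose[OF _ assms] measurable_component_singleton)

text \<open>A product probability measure is determined by its values on finite-dimensional
  cylinders, and a coordinatewise map pulls a cylinder back to the cylinder over the
  preimages.\<close>

lemma PiM_distr:
  assumes "prob_space M" and T: "T \<in> measurable M N"
  shows "PiM I (\<lambda>_. distr M N T) = distr (PiM I (\<lambda>_. M)) (PiM I (\<lambda>_. N)) (\<lambda>\<omega>. \<lambda>i\<in>I. T (\<omega> i))"
proof -
  interpret M: prob_space M by fact
  interpret D: prob_space "distr M N T" by (rule M.prob_space_distr[OF T])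
  interpret P: product_prob_space "\<lambda>_. distr M N T" I ..
  show ?thesis
  proof (rule P.PiM_eq[symmetric])
    show "sets (distr (PiM I (\<lambda>_. M)) (PiM I (\<lambda>_. N)) (\<lambda>\<omega>. \<lambda>i\<in>I. T (\<omega> i))) =
        sets (PiM I (\<lambda>_. distr M N T))"
      unfolding sets_distr by (rule sets_PiM_cong) simp_all
  next
    fix J F
    assume J: "finite J" "J \<subseteq> I" and F: "\<And>j. j \<in> J \<Longrightarrow> F j \<in> sets (distr M N T)"
    let ?E = "prod_emb I (\<lambda>_. distr M N T) J (Pi\<^sub>E J F)"
    \<comment> \<open>\<open>prod_emb\<close> sees only the spaces of the factors, and
      \<open>distr M N T\<close> has the space of \<open>N\<close>.\<close>
    have E: "?E = prod_emb I (\<lambda>_. N) J (Pi\<^sub>E J F)"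
      by (simp add: prod_emb_def)
    have "(\<lambda>\<omega>. \<lambda>i\<in>I. T (\<omega> i)) -` prod_emb I (\<lambda>_. N) J (Pi\<^sub>E J F) \<inter> space (PiM I (\<lambda>_. M)) =
        prod_emb I (\<lambda>_. M) J (\<Pi>\<^sub>E j\<in>J. T -` F j \<inter> space M)"
      (is "?L = ?R")
    proof (rule set_eqI)
      fix \<omega>
      show "\<omega> \<in> ?L \<longleftrightarrow> \<omega> \<in> ?R"
      proof (cases "\<omega> \<in> space (PiM I (\<lambda>_. M))")
        case True
        then have "\<omega> i \<in> space M" if "i \<in> I" for i
          using that by (auto simp: space_PiM)
        with True subsetD[OF J(2)] measurable_space[OF T] show ?thesis
          by (simp add: prod_emb_def space_PiM PiE_iff Int_absorb1[OF J(2)])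
      qed (simp add: prod_emb_def space_PiM)
    qed
    then have "emeasure (distr (PiM I (\<lambda>_. M)) (PiM I (\<lambda>_. N)) (\<lambda>\<omega>. \<lambda>i\<in>I. T (\<omega> i))) ?E =
        emeasure (PiM I (\<lambda>_. M)) (prod_emb I (\<lambda>_. M) J (\<Pi>\<^sub>E j\<in>J. T -` F j \<inter> space M))"
      unfolding E using J F by (subst emeasure_distr[OF measurable_PiM_map[OF T]]) (auto intro!: sets_PiM_I)
    also have "\<dots> = (\<Prod>j\<in>J. emeasure M (T -` F j \<inter> space M))"
      using J F measurable_sets[OF T] by (intro emeasure_PiM_emb assms) auto
    also have "\<dots> = (\<Prod>j\<in>J. emeasure (distr M N T) (F j))"
      using F by (intro prod.cong) (auto simp: emeasure_distr[OF T])
    finally show "emeasure (distr (PiM I (\<lambda>_. M)) (PiM I (\<lambda>_. N)) (\<lambda>\<omega>. \<lambda>i\<in>I. T (\<omega> i))) ?E =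
        (\<Prod>j\<in>J. emeasure (distr M N T) (F j))" .
  qed
qed

section \<open>Existence and uniqueness of the pseudoinverse\<close>

lemma sum_matrix_vector_mult:
  "(\<Sum>i\<in>I. A i) *v v = (\<Sum>i\<in>I. A i *v v)" for A :: "'i \<Rightarrow> real^'n^'m"
  by (induction I rule: infinite_finite_induct) (simp_all add: matrix_vector_mult_add_rdistrib)

lemma outer_mult_vector: "outer u v *v w = (v \<bullet> w) *\<^sub>R u"
  by (simp add: outer_def matrix_vector_mult_def vec_eq_iff inner_vec_def sum_distrib_left
      mult_ac)

lemma pinv_prod_mult_vector: "pinv_prod \<tau> G *v w = (\<Sum>i<nrows \<tau>. (data \<tau> i \<bullet> w) *\<^sub>R G i)"
  by (simp add: pinv_prod_def sum_matrix_vector_mult outer_mult_vector)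

lemma symmetric_matrix_inner:
  fixes A :: "real^'n^'n"
  assumes "transpose A = A"
  shows "(A *v u) \<bullet> v = u \<bullet> (A *v v)"
  by (metis assms dot_lmul_matrix vector_transpose_matrix)

lemma symmetric_matrixI:
  fixes A :: "real^'n^'n"
  assumes "\<And>u v. (A *v u) \<bullet> v = u \<bullet> (A *v v)"
  shows "transpose A = A"
proof -
  have "(transpose A *v u) \<bullet> v = (A *v u) \<bullet> v" for u v
    by (simp add: assms dot_lmul_matrix)
  then show ?thesis by (metis matrix_eq vector_eq_rdot)
qed

text \<open>The witness is the sum of \<open>outer b b\<close> over an orthonormal basis of
  \<open>span S\<close>.\<close>

lemma orthogonal_projector_exists:
  fixes S :: "(real^'n) set"
  obtains Q :: "real^'n^'n"
  where "transpose Q = Q" "\<And>x. x \<in> span S \<Longrightarrow> Q *v x = x" "\<And>v. Q *v v \<in> span S"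
proof -
  obtain B where B: "B \<subseteq> span S" "pairwise orthogonal B" "\<And>x. x \<in> B \<Longrightarrow> norm x = 1"
    "independent B" "span B = span S"
    using orthonormal_basis_subspace[OF subspace_span] by metis
  have fin: "finite B"
    using B(4) by (rule independent_imp_finite)
  define Q :: "real^'n^'n" where "Q = (\<Sum>b\<in>B. outer b b)"
  have Q: "Q *v v = (\<Sum>b\<in>B. (b \<bullet> v) *\<^sub>R b)" for v
    by (simp add: Q_def sum_matrix_vector_mult outer_mult_vector)
  show thesis
  proof
    show "transpose Q = Q"
      by (rule symmetric_matrixI)
        (simp add: Q inner_sum_left inner_sum_right inner_commute mult.commute)
    show "Q *v x = x" if "x \<in> span S" for x
      using orthonormal_basis_expand[OF B(2) B(3), of x] that fin B(5)
      by (simp add: Q inner_commute)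
    show "Q *v v \<in> span S" for v
      using B(1) by (auto simp: Q intro!: span_sum span_scale)
  qed
qed

text \<open>First GX = HX and XG = XH are shown; then G = (GX)G = (HX)G = H(XG) = H(XH) = H.\<close>

lemma is_pinv_unique:
  assumes G: "is_pinv \<tau> G" and H: "is_pinv \<tau> H"
  shows "G = H"
proof -
  let ?n = "nrows \<tau>" and ?x = "data \<tau>"
  have fix_row: "pinv_prod \<tau> K *v ?x i = ?x i" if "is_pinv \<tau> K" "i < ?n" for K i
    using that unfolding is_pinv_def by (metis vector_transpose_matrix)
  \<comment> \<open>In matrix form (KX)(LX) = K(X(LX)) = KX.\<close>
  have prod_absorb: "pinv_prod \<tau> K *v (pinv_prod \<tau> L *v v) = pinv_prod \<tau> K *v v"
    if "is_pinv \<tau> K" "is_pinv \<tau> L" for K L v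
  proof -
    have "?x i \<bullet> (pinv_prod \<tau> L *v v) = ?x i \<bullet> v" if "i < ?n" for i
      using symmetric_matrix_inner[of "pinv_prod \<tau> L" "?x i" v] fix_row[of L i] that
        \<open>is_pinv \<tau> L\<close> by (simp add: is_pinv_def)
    then show ?thesis
      by (simp add: pinv_prod_mult_vector[of \<tau> K])
  qed
  have "(pinv_prod \<tau> G *v u) \<bullet> v = (pinv_prod \<tau> H *v u) \<bullet> v" for u v
  proof -
    have sym: "transpose (pinv_prod \<tau> G) = pinv_prod \<tau> G"
      "transpose (pinv_prod \<tau> H) = pinv_prod \<tau> H"
      using G H by (auto simp: is_pinv_def)
    \<comment> \<open>GX = (GX)(HX); moving both symmetric factors to the other side reverses them
      to (HX)(GX), which collapses to HX.\<close>
    have "(pinv_prod \<tau> G *v u) \<bullet> v = (pinv_prod \<tau> G *v (pinv_prod \<tau> H *v u)) \<bullet> v"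
      by (simp add: prod_absorb G H)
    also have "\<dots> = u \<bullet> (pinv_prod \<tau> H *v (pinv_prod \<tau> G *v v))"
      by (simp add: symmetric_matrix_inner sym)
    also have "\<dots> = (pinv_prod \<tau> H *v u) \<bullet> v"
      by (simp add: prod_absorb G H symmetric_matrix_inner sym)
    finally show ?thesis .
  qed
  then have GH: "pinv_prod \<tau> G = pinv_prod \<tau> H"
    by (metis matrix_eq vector_eq_rdot)
  \<comment> \<open>In matrix notation \<open>XH = (XG)(XH)\<close>, and \<open>XG\<close>, \<open>XH\<close> are symmetric.\<close>
  have expand: "?x i \<bullet> L j = (\<Sum>k<?n. (?x i \<bullet> K k) * (?x k \<bullet> L j))"
    if "is_pinv \<tau> K" "is_pinv \<tau> L" "i < ?n" "j < ?n" for K L i j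
  proof -
    have "?x i \<bullet> L j = (pinv_prod \<tau> K *v ?x i) \<bullet> L j"
      using fix_row that by simp
    also have "\<dots> = ?x i \<bullet> (pinv_prod \<tau> K *v L j)"
      using that by (simp add: symmetric_matrix_inner is_pinv_def)
    also have "\<dots> = (\<Sum>k<?n. (?x i \<bullet> K k) * (?x k \<bullet> L j))"
      by (simp add: pinv_prod_mult_vector inner_sum_right mult.commute)
    finally show ?thesis .
  qed
  have XG_XH: "?x i \<bullet> G j = ?x i \<bullet> H j" if "i < ?n" "j < ?n" for i j
  proof -
    have "?x i \<bullet> G j = ?x j \<bullet> G i"
      using G that by (simp add: is_pinv_def)
    also have "\<dots> = (\<Sum>k<?n. (?x j \<bullet> H k) * (?x k \<bullet> G i))"
      using expand[OF H G] that by blast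
    \<comment> \<open>Transposing turns the entry (j, i) of (XH)(XG) into the entry (i, j) of
      (XG)(XH).\<close>
    also have "\<dots> = (\<Sum>k<?n. (?x i \<bullet> G k) * (?x k \<bullet> H j))"
      using G H that by (intro sum.cong) (auto simp: is_pinv_def)
    also have "\<dots> = ?x i \<bullet> H j"
      using expand[OF G H] that by simp
    finally show ?thesis .
  qed
  have "G j = H j" for j
  proof (cases "j < ?n")
    case True
    have "G j = pinv_prod \<tau> H *v G j"
      using G True by (simp add: GH[symmetric] is_pinv_def)
    also have "\<dots> = pinv_prod \<tau> H *v H j"
      using True by (simp add: pinv_prod_mult_vector XG_XH)
    also have "\<dots> = H j"
      using H True by (simp add: is_pinv_def)
    finally show ?thesis .
  qed (use G H in \<open>auto simp: is_pinv_def\<close>)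
  then show ?thesis ..
qed

text \<open>
  With \<open>Q\<close> the orthogonal projector onto the row space, the matrix \<open>X\<^sup>T X + (I - Q)\<close> is
  positive definite, and its inverse times \<open>X\<^sup>T\<close> is the pseudoinverse of \<open>X\<close>.
\<close>

lemma is_pinv_exists:
  fixes \<tau> :: "'d::finite task"
  shows "\<exists>G. is_pinv \<tau> G"
proof -
  let ?n = "nrows \<tau>" and ?x = "data \<tau>"
  obtain Q :: "real^'d^'d" where Q_sym: "transpose Q = Q"
    and Q_id: "\<And>x. x \<in> span (?x ` {..<?n}) \<Longrightarrow> Q *v x = x"
    and Q_range: "\<And>v. Q *v v \<in> span (?x ` {..<?n})"
    using orthogonal_projector_exists[of "?x ` {..<?n}"] by blast
  have Q_row: "Q *v ?x i = ?x i" if "i < ?n" for i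
    using that by (intro Q_id span_base) auto
  have row_Q: "?x i \<bullet> (Q *v v) = ?x i \<bullet> v" if "i < ?n" for i v
    using symmetric_matrix_inner[OF Q_sym, of "?x i" v] Q_row[OF that] by simp
  have QQ: "Q *v (Q *v v) = Q *v v" for v
    by (intro Q_id Q_range)
  \<comment> \<open>\<open>pinv_prod \<tau> ?x\<close> is X^T X; adding \<open>mat 1 - Q\<close>
    makes it invertible by acting as the identity on null(X).\<close>
  define A where "A = pinv_prod \<tau> ?x + (mat 1 - Q)"
  have A: "A *v v = (\<Sum>i<?n. (?x i \<bullet> v) *\<^sub>R ?x i) + (v - Q *v v)" for v
    by (simp add: A_def matrix_vector_mult_add_rdistrib matrix_vector_mult_diff_rdistrib
        pinv_prod_mult_vector)
  have A_sym: "(A *v u) \<bullet> v = u \<bullet> (A *v v)" for u v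
    by (simp add: A inner_add_left inner_add_right inner_diff_left inner_diff_right
        inner_sum_left inner_sum_right symmetric_matrix_inner[OF Q_sym]
        inner_commute[of _ "data \<tau> _"]
        mult.commute)
  have A_inj: "v = 0" if "A *v v = 0" for v
  proof -
    have "(norm (v - Q *v v))\<^sup>2 = v \<bullet> (v - Q *v v)"
      by (simp add: power2_norm_eq_inner inner_diff_left inner_diff_right
          symmetric_matrix_inner[OF Q_sym] QQ)
    \<comment> \<open>If \<open>A *v v = 0\<close>, both squares vanish: \<open>v\<close> lies in
      the row space and is orthogonal to every row, hence is 0.\<close>
    then have "v \<bullet> (A *v v) = (\<Sum>i<?n. (?x i \<bullet> v)\<^sup>2) + (norm (v - Q *v v))\<^sup>2"
      by (simp add: A inner_add_right inner_sum_right inner_commute power2_eq_square)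
    moreover have "(\<Sum>i<?n. (?x i \<bullet> v)\<^sup>2) \<ge> 0"
      by (intro sum_nonneg) simp
    ultimately have rows: "(\<Sum>i<?n. (?x i \<bullet> v)\<^sup>2) = 0" and "(norm (v - Q *v v))\<^sup>2 = 0"
      using that by (auto simp: add_nonneg_eq_0_iff)
    then have v: "v \<in> span (?x ` {..<?n})"
      using Q_range[of v] by simp
    from rows have "orthogonal v x" if "x \<in> ?x ` {..<?n}" for x
      using that by (auto simp: sum_nonneg_eq_0_iff orthogonal_def inner_commute)
    from orthogonal_to_span[OF v this] show "v = 0"
      by (simp add: orthogonal_self)
  qed
  obtain K where KA: "K ** A = mat 1"
    using A_inj matrix_left_invertible_ker by blast
  then have AK: "A ** K = mat 1"
    by (simp add: matrix_left_right_inverse)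
  have KAv: "K *v (A *v v) = v" and AKv: "A *v (K *v v) = v" for v
    by (simp_all add: matrix_vector_mul_assoc KA AK)
  have K_sym: "(K *v u) \<bullet> v = u \<bullet> (K *v v)" for u v
    using A_sym[of "K *v u" "K *v v"] by (simp add: AKv)
  \<comment> \<open>\<open>Q\<close> fixes the rows, so X^T X absorbs it on either side, and it
    commutes with \<open>mat 1 - Q\<close>; the inverse \<open>K\<close> inherits commutation with
    \<open>Q\<close>.\<close>
  have AQ: "A *v (Q *v v) = Q *v (A *v v)" for v
    by (simp add: A QQ row_Q matrix_vector_right_distrib matrix_vector_mult_diff_distrib
          matrix_vector_mult_scaleR Q_row linear_sum[OF matrix_vector_mul_linear])
  have KQ: "K *v (Q *v v) = Q *v (K *v v)" for v
    using AQ[of "K *v v"] KAv[of "Q *v (K *v v)"] by (simp add: AKv)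
  define G where "G j = (if j < ?n then K *v ?x j else 0)" for j
  have "pinv_prod \<tau> G *v v = Q *v v" for v
  proof -
    \<comment> \<open>Since (I - Q)Q = 0 and XQ = X, the product AQ is X^T X, so GX = K X^T X = KAQ
      = Q.\<close>
    have "pinv_prod \<tau> G *v v = K *v (A *v (Q *v v))"
      by (simp add: A QQ row_Q pinv_prod_mult_vector G_def matrix_vector_mult_scaleR
          linear_sum[OF matrix_vector_mul_linear])
    then show ?thesis by (simp add: KAv)
  qed
  then have GQ: "pinv_prod \<tau> G = Q"
    by (simp add: matrix_eq)
  have "is_pinv \<tau> G"
    unfolding is_pinv_def GQ
  proof (intro conjI allI impI)
    show "?x i v* Q = ?x i" if "i < ?n" for i
      using Q_row[OF that] Q_sym by (metis vector_transpose_matrix)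
    show "Q *v G j = G j" if "j < ?n" for j
      using that by (simp add: G_def KQ[symmetric] Q_row)
    show "?x i \<bullet> G j = ?x j \<bullet> G i" if "i < ?n" "j < ?n" for i j
      using that K_sym[of "?x j" "?x i"] by (simp add: G_def inner_commute)
  qed (simp_all add: G_def Q_sym)
  then show ?thesis by blast
qed

lemma pinv_eqI: "is_pinv \<tau> G \<Longrightarrow> pinv \<tau> = G"
  unfolding pinv_def by (blast intro: is_pinv_unique)

lemma is_pinv_pinv: "is_pinv \<tau> (pinv \<tau>)"
  using is_pinv_exists pinv_eqI by metis

section \<open>Rescaled tasks\<close>

lemma rescale_simps [simp]:
  "nrows (rescale \<epsilon> \<tau>) = nrows \<tau>"
  "data (rescale \<epsilon> \<tau>) i = \<epsilon> *\<^sub>R data \<tau> i"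
  "label (rescale \<epsilon> \<tau>) i = \<epsilon> * label \<tau> i"
  by (simp_all add: rescale_def nrows_def data_def label_def)

lemma rescale_inverse: "\<epsilon> \<noteq> 0 \<Longrightarrow> rescale \<epsilon> (rescale (inverse \<epsilon>) \<tau>) = \<tau>"
  by (simp add: rescale_def nrows_def data_def label_def mult.assoc[symmetric])

lemma measurable_rescale: "rescale \<epsilon> \<in> measurable task_space task_space"
proof -
  have "rescale \<epsilon> \<in> borel_measurable (borel :: 'd::finite task measure)"
    unfolding rescale_def nrows_def data_def label_def
    by (intro borel_measurable_continuous_onI continuous_intros
        continuous_on_product_then_coordinatewise)
  \<comment> \<open>Rescaling is continuous, as continuity into a function space is coordinatewise;
    it keeps the number of rows and the zero padding, so it restricts to the task space.\<close>
  then show ?thesis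
    unfolding task_space_def by (rule measurable_restrict_space3) auto
qed

lemma pinv_prod_rescale:
  assumes "\<epsilon> \<noteq> 0"
  shows "pinv_prod (rescale \<epsilon> \<tau>) (\<lambda>j. inverse \<epsilon> *\<^sub>R G j) = pinv_prod \<tau> G"
  using assms by (simp add: matrix_eq pinv_prod_mult_vector field_simps)

text \<open>Both products GX and XG are unchanged, while rows scale by \<epsilon> and columns of G
  by its inverse, so every Penrose equation is homogeneous.\<close>

lemma is_pinv_rescale:
  assumes "\<epsilon> \<noteq> 0" and "is_pinv \<tau> G"
  shows "is_pinv (rescale \<epsilon> \<tau>) (\<lambda>j. inverse \<epsilon> *\<^sub>R G j)"
  using assms(2) unfolding is_pinv_def pinv_prod_rescale[OF assms(1)]
  by (simp add: assms(1) scaleR_vector_matrix_assoc matrix_vector_mult_scaleR)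

lemma proj_rescale:
  assumes "\<epsilon> \<noteq> 0"
  shows "proj (rescale \<epsilon> \<tau>) = proj \<tau>"
  unfolding proj_def pinv_eqI[OF is_pinv_rescale[OF assms is_pinv_pinv]]
  by (simp add: pinv_prod_rescale assms)

lemma proj_prod_rescale:
  "\<epsilon> \<noteq> 0 \<Longrightarrow> proj_prod (\<lambda>i. rescale \<epsilon> (\<omega> i)) m = proj_prod \<omega> m"
  by (induction m) (simp_all add: proj_rescale)

section \<open>Iterates and losses of rescaled tasks\<close>

lemma fits_rescale: "\<epsilon> \<noteq> 0 \<Longrightarrow> fits (rescale \<epsilon> \<tau>) = fits \<tau>"
  by (simp add: fits_def fun_eq_iff)

text \<open>By induction the previous iterate, hence the objective, is the same, and
  \<open>fits\<close> is the same predicate; the two \<open>ARG_MIN\<close> terms therefore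
  coincide.\<close>

lemma iterate_rescale: "\<epsilon> \<noteq> 0 \<Longrightarrow> iterate (\<lambda>i. rescale \<epsilon> (\<omega> i)) k = iterate \<omega> k"
  by (induction k) (simp_all add: fits_rescale)

lemma loss_rescale: "loss (rescale \<epsilon> \<tau>) w = \<epsilon>\<^sup>2 * loss \<tau> w"
  by (simp add: loss_def right_diff_distrib[symmetric] power_mult_distrib sum_distrib_left[symmetric])

lemma avg_loss_rescale:
  "\<epsilon> \<noteq> 0 \<Longrightarrow> avg_loss k (\<lambda>i. rescale \<epsilon> (\<omega> i)) = \<epsilon>\<^sup>2 * avg_loss k \<omega>"
  by (simp add: avg_loss_def iterate_rescale loss_rescale sum_distrib_left[symmetric])

section \<open>Rescaled laws\<close>

lemma measurable_rescale_law:
  assumes "sets \<mu> = sets task_space"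
  shows "rescale \<epsilon> \<in> measurable \<mu> task_space" "rescale \<epsilon> \<in> measurable task_space \<mu>"
  using measurable_rescale measurable_cong_sets[OF assms refl] measurable_cong_sets[OF refl assms]
  by blast+

lemma integral_rescaled_law:
  fixes f :: "'d::finite task \<Rightarrow> 'c::{banach, second_countable_topology}"
  assumes "sets \<mu> = sets task_space" "\<epsilon> \<noteq> 0"
  shows "(\<integral>\<tau>. f \<tau> \<partial>rescaled_law \<epsilon> \<mu>) = (\<integral>\<tau>. f (rescale \<epsilon> \<tau>) \<partial>\<mu>)"
  unfolding rescaled_law_def
  by (rule integral_distr_isomorphism[where T' = "rescale (inverse \<epsilon>)"])
    (simp_all add: measurable_rescale_law assms rescale_inverse)

lemma proj_law_rescaled_law:
  assumes "sets \<mu> = sets task_space" "\<epsilon> \<noteq> 0"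
  shows "proj_law (rescaled_law \<epsilon> \<mu>) = proj_law \<mu>"
proof -
  have "proj_law (rescaled_law \<epsilon> \<mu>) = distr \<mu> borel (\<lambda>\<tau>. proj (rescale \<epsilon> \<tau>))"
    unfolding proj_law_def rescaled_law_def
    by (rule distr_distr_isomorphism[where T' = "rescale (inverse \<epsilon>)"])
      (simp_all add: measurable_rescale_law assms rescale_inverse)
  then show ?thesis
    by (simp add: proj_rescale assms proj_law_def)
qed

text \<open>The rescaled i.i.d. law is the image of the original one under coordinatewise rescaling,
  an isomorphism of sequence spaces inverted by rescaling with
  \<open>inverse \<epsilon>\<close>.\<close>

lemma integral_iid_rescaled_law:
  fixes f :: "(nat \<Rightarrow> 'd::finite task) \<Rightarrow> 'c::{banach, second_countable_topology}"
  assumes "prob_space \<mu>" and sets: "sets \<mu> = sets task_space" and \<epsilon>: "\<epsilon> \<noteq> 0"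
  shows "(\<integral>\<omega>. f \<omega> \<partial>iid (rescaled_law \<epsilon> \<mu>)) = (\<integral>\<omega>. f (\<lambda>i. rescale \<epsilon> (\<omega> i)) \<partial>iid \<mu>)"
proof -
  have "iid (rescaled_law \<epsilon> \<mu>) =
      distr (iid \<mu>) (PiM UNIV (\<lambda>_. task_space)) (\<lambda>\<omega> i. rescale \<epsilon> (\<omega> i))"
    using PiM_distr[OF assms(1) measurable_rescale_law(1)[OF sets, of \<epsilon>], of UNIV]
    by (simp add: iid_def rescaled_law_def restrict_UNIV)
  also have "(\<integral>\<omega>. f \<omega> \<partial>\<dots>) = (\<integral>\<omega>. f (\<lambda>i. rescale \<epsilon> (\<omega> i)) \<partial>iid \<mu>)"
  proof (rule integral_distr_isomorphism[where T' = "\<lambda>\<omega> i. rescale (inverse \<epsilon>) (\<omega> i)"])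
    show "(\<lambda>\<omega> i. rescale \<epsilon> (\<omega> i)) \<in> measurable (iid \<mu>) (PiM UNIV (\<lambda>_. task_space))"
      using measurable_PiM_map[OF measurable_rescale_law(1)[OF sets, of \<epsilon>], of UNIV]
      by (simp add: iid_def restrict_UNIV)
    show "(\<lambda>\<omega> i. rescale (inverse \<epsilon>) (\<omega> i)) \<in> measurable (PiM UNIV (\<lambda>_. task_space)) (iid \<mu>)"
      using measurable_PiM_map[OF measurable_rescale_law(2)[OF sets, of "inverse \<epsilon>"], of UNIV]
      by (simp add: iid_def restrict_UNIV)
  qed (simp add: rescale_inverse \<epsilon>)
  finally show ?thesis .
qed

theorem propositionC10:
  fixes \<mu> :: "'d::finite task measure" and \<epsilon> :: real
  assumes "task_law \<mu>" and "realizable \<mu>" and "finite_expectations \<mu>" and "\<epsilon> > 0"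
  shows
    "((\<forall>\<tau>\<in>space task_space. proj (rescale \<epsilon> \<tau> :: 'd task) = proj \<tau>) \<and>
      proj_law (rescaled_law \<epsilon> \<mu>) = proj_law \<mu> \<and>
      mean_proj (rescaled_law \<epsilon> \<mu>) = mean_proj \<mu> \<and>
      (\<forall>A. transpose A = A \<longrightarrow> S_op (rescaled_law \<epsilon> \<mu>) A = S_op \<mu> A) \<and>
      rho (rescaled_law \<epsilon> \<mu>) = rho \<mu> \<and>
      (\<forall>k\<ge>1. R_proj (rescaled_law \<epsilon> \<mu>) k = R_proj \<mu> k) \<and>
      (\<forall>m. f_seq (rescaled_law \<epsilon> \<mu>) m = f_seq \<mu> m) \<and>
      (\<forall>m\<ge>1. kappa (rescaled_law \<epsilon> \<mu>) m = kappa \<mu> m) \<and>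
      lam (rescaled_law \<epsilon> \<mu>) = lam \<mu> \<and>
      nu (rescaled_law \<epsilon> \<mu>) = nu \<mu> \<and>
      (\<forall>\<Phi> :: (real^'d^'d) measure \<Rightarrow> 'c.
         \<Phi> (proj_law (rescaled_law \<epsilon> \<mu>)) = \<Phi> (proj_law \<mu>))) \<and>
     (\<forall>k\<ge>1. forgetting (rescaled_law \<epsilon> \<mu>) k = \<epsilon>\<^sup>2 * forgetting \<mu> k)"
proof -
  have prob: "prob_space \<mu>" and sets: "sets \<mu> = sets task_space"
    using assms(1) by (simp_all add: task_law_def)
  have \<epsilon>: "\<epsilon> \<noteq> 0"
    using assms(4) by simp
  note integral = integral_rescaled_law[OF sets \<epsilon>] and
    integral_iid = integral_iid_rescaled_law[OF prob sets \<epsilon>]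
  note proj_law = proj_law_rescaled_law[OF sets \<epsilon>]
  have mean_proj: "mean_proj (rescaled_law \<epsilon> \<mu>) = mean_proj \<mu>"
    by (simp add: mean_proj_def integral proj_rescale \<epsilon>)
  \<comment> \<open>Equality as functions allows rewriting inside the supremum of \<open>rho\<close>
    and the powers in \<open>kappa\<close>.\<close>
  have S_op: "S_op (rescaled_law \<epsilon> \<mu>) = S_op \<mu>"
    by (simp add: S_op_def fun_eq_iff integral proj_rescale \<epsilon>)
  have R_proj: "R_proj (rescaled_law \<epsilon> \<mu>) k = R_proj \<mu> k" for k
    by (simp add: R_proj_def integral_iid proj_rescale proj_prod_rescale \<epsilon>)
  have f_seq: "f_seq (rescaled_law \<epsilon> \<mu>) m = f_seq \<mu> m" for m
    by (simp add: f_seq_def integral_iid proj_rescale proj_prod_rescale \<epsilon>)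
  have "forgetting (rescaled_law \<epsilon> \<mu>) k = \<epsilon>\<^sup>2 * forgetting \<mu> k" for k
    by (simp add: forgetting_def integral_iid avg_loss_rescale \<epsilon>)
  \<comment> \<open>The remaining quantities are built from \<open>S_op\<close> and
    \<open>mean_proj\<close>; the clause on \<open>\<Phi>\<close> follows by rewriting with the
    equality of projector laws.\<close>
  then show ?thesis
    by (simp add: proj_rescale \<epsilon> proj_law mean_proj S_op R_proj f_seq
        rho_def kappa_def lam_def nu_def)
qed

end
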